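(* Let $n\ge 1$ and let $f\in\mathbb{R}[X_1,\dots,X_n]$ with $d:=\deg f>0$ and leading form $f_d$. Consider the following properties: (a) $f_d>0$ (i.e. $f_d$ is positive definite); (b) for every $z\in\mathbb{R}$ the sublevel set $\mathcal{L}_{\le}^f(z)=\{x\in\mathbb{R}^n \mid f(x)\le z\}$ is compact; (b') $\liminf_{\|x\|\to+\infty} f(x)=+\infty$ ($x\in\mathbb{R}^n$); (c) $f$ has an integer minimizer; (c') $f$ has a continuous minimizer; (e) $\inf_{x\in\mathbb{Z}^n} f(x)>-\infty$; (e') $\inf_{x\in\mathbb{R}^n} f(x)>-\infty$; (g) $f_d\ge 0$ (i.e. $f_d$ is positive semidefinite); (h) $d$ is even. Then the following implications hold: $$(a)\Rightarrow(b)\Rightarrow(c)\Rightarrow(e)\Rightarrow(g)\Rightarrow(h),\qquad (b)\Leftrightarrow(b'),\qquad (b')\Rightarrow(c')\Rightarrow(e')\Rightarrow(e).$$ Moreover, none of these implications can be strengthened: for each of the one-directional implications $(a)\Rightarrow(b)$, $(b)\Rightarrow(c)$, $(c)\Rightarrow(e)$, $(e)\Rightarrow(g)$, $(g)\Rightarrow(h)$, $(b')\Rightarrow(c')$, $(c')\Rightarrow(e')$, $(e')\Rightarrow(e)$ the converse implication fails in general, i.e. there exist $n$ and a polynomial $f\in\mathbb{R}[X_1,\dots,X_n]$ of positive degree for which the converse is false.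
   Context: Every polynomial $f\in\mathbb{R}[X_1,\dots,X_n]$ of degree $d$ decomposes uniquely as $f=\sum_{j=0}^d f_j$ with $f_j$ homogeneous of degree $j$; $f_d$ is called the leading form of $f$. A homogeneous polynomial $g$ is positive definite ($g>0$) if $g(x)>0$ for all $x\in\mathbb{R}^n\setminus\{0\}$; a polynomial $g$ is positive semidefinite ($g\ge 0$) if $g(x)\ge 0$ for all $x\in\mathbb{R}^n$. An integer minimizer of $f$ is a point $x^*\in\mathbb{Z}^n$ with $f(x^* )=\inf_{x\in\mathbb{Z}^n} f(x)$; a continuous minimizer of $f$ is a point $x^*\in\mathbb{R}^n$ with $f(x^* )=\inf_{x\in\mathbb{R}^n} f(x)$. *)

theory Defs
  imports "HOL-Analysis.Analysis" "HOL-Library.Poly_Mapping"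
begin

text \<open>
  A monomial is a finitely supported exponent vector, and a real polynomial is a finitely
  supported family of coefficients indexed by monomials. Addition and multiplication of
  polynomials are those of \<^theory>\<open>HOL-Library.Poly_Mapping\<close>. The ring of polynomials in
  \<open>X\<^sub>1, \<dots>, X\<^sub>n\<close> consists of those polynomials whose variables all have index below \<open>n\<close>
  (indices start at 0).
\<close>

type_synonym monomial = "nat \<Rightarrow>\<^sub>0 nat"
type_synonym rpoly = "monomial \<Rightarrow>\<^sub>0 real"

definition poly_ring :: "nat \<Rightarrow> rpoly set" where
  "poly_ring n = {f. \<forall>m\<in>Poly_Mapping.keys f. Poly_Mapping.keys m \<subseteq> {..<n}}"

definition eval_poly :: "rpoly \<Rightarrow> (nat \<Rightarrow> real) \<Rightarrow> real" where
  "eval_poly f x =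
     (\<Sum>m\<in>Poly_Mapping.keys f. Poly_Mapping.lookup f m *
        (\<Prod>i\<in>Poly_Mapping.keys m. x i ^ Poly_Mapping.lookup m i))"

definition monom_degree :: "monomial \<Rightarrow> nat" where
  "monom_degree m = (\<Sum>i\<in>Poly_Mapping.keys m. Poly_Mapping.lookup m i)"

text \<open>The zero polynomial gets degree 0.\<close>

definition total_degree :: "rpoly \<Rightarrow> nat" where
  "total_degree f = Max (insert 0 (monom_degree ` Poly_Mapping.keys f))"

definition homogeneous :: "nat \<Rightarrow> rpoly \<Rightarrow> bool" where
  "homogeneous j g \<longleftrightarrow> (\<forall>m\<in>Poly_Mapping.keys g. monom_degree m = j)"

definition hom_component :: "nat \<Rightarrow> rpoly \<Rightarrow> rpoly" where
  "hom_component j f =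
     (\<Sum>m\<in>{m\<in>Poly_Mapping.keys f. monom_degree m = j}.
        Poly_Mapping.single m (Poly_Mapping.lookup f m))"

definition leading_form :: "rpoly \<Rightarrow> rpoly" where
  "leading_form f = hom_component (total_degree f) f"

lemma lookup_hom_component:
  "Poly_Mapping.lookup (hom_component j f) m =
     (if monom_degree m = j then Poly_Mapping.lookup f m else 0)"
proof -
  have "Poly_Mapping.lookup (hom_component j f) m =
      (\<Sum>k\<in>{k\<in>Poly_Mapping.keys f. monom_degree k = j}.
         if k = m then Poly_Mapping.lookup f m else 0)"
    unfolding hom_component_def lookup_sum
    by (rule sum.cong) (auto simp: lookup_single when_def)
  also have "\<dots> = (if m \<in> Poly_Mapping.keys f \<and> monom_degree m = j
                    then Poly_Mapping.lookup f m else 0)"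
    by (subst sum.delta) auto
  finally show ?thesis
    by (auto simp: in_keys_iff)
qed

lemma homogeneous_hom_component: "homogeneous j (hom_component j f)"
  by (auto simp: homogeneous_def in_keys_iff lookup_hom_component split: if_splits)

lemma sum_hom_component: "(\<Sum>j\<le>total_degree f. hom_component j f) = f"
proof (rule poly_mapping_eqI)
  fix m
  have deg: "monom_degree m \<le> total_degree f" if "m \<in> Poly_Mapping.keys f"
    unfolding total_degree_def by (rule Max_ge) (use that in auto)
  have "Poly_Mapping.lookup (\<Sum>j\<le>total_degree f. hom_component j f) m =
      (\<Sum>j\<le>total_degree f. if monom_degree m = j then Poly_Mapping.lookup f m else 0)"
    by (simp add: lookup_sum lookup_hom_component)
  also have "\<dots> = Poly_Mapping.lookup f m"
    using deg by (auto simp: in_keys_iff)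
  finally show "Poly_Mapping.lookup (\<Sum>j\<le>total_degree f. hom_component j f) m =
      Poly_Mapping.lookup f m" .
qed

lemma hom_component_unique:
  assumes "f = (\<Sum>j\<le>d. g j)" and "\<And>j. j \<le> d \<Longrightarrow> homogeneous j (g j)" and "j \<le> d"
  shows "g j = hom_component j f"
proof (rule poly_mapping_eqI)
  fix m
  have g: "Poly_Mapping.lookup (g i) m = (if i = monom_degree m then Poly_Mapping.lookup (g i) m else 0)"
    if "i \<le> d" for i
    using assms(2)[OF that] by (auto simp: homogeneous_def in_keys_iff)
  have "Poly_Mapping.lookup f m =
      (\<Sum>i\<le>d. if i = monom_degree m then Poly_Mapping.lookup (g i) m else 0)"
    unfolding assms(1) lookup_sum by (rule sum.cong) (use g in auto)
  also have "\<dots> = (if monom_degree m \<le> d then Poly_Mapping.lookup (g (monom_degree m)) m else 0)"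
    by simp
  finally show "Poly_Mapping.lookup (g j) m = Poly_Mapping.lookup (hom_component j f) m"
    using g[OF assms(3)] assms(3) by (auto simp: lookup_hom_component)
qed

text \<open>
  Points of \<open>\<real>\<^sup>n\<close> are the functions on the natural numbers vanishing from index \<open>n\<close> on, i.e. the
  carrier of the library topology \<^const>\<open>Euclidean_space\<close>.
\<close>

definition real_points :: "nat \<Rightarrow> (nat \<Rightarrow> real) set" where
  "real_points n = topspace (Euclidean_space n)"

definition int_points :: "nat \<Rightarrow> (nat \<Rightarrow> real) set" where
  "int_points n = {x \<in> real_points n. \<forall>i<n. x i \<in> \<int>}"

definition positive_definite :: "nat \<Rightarrow> rpoly \<Rightarrow> bool" where
  "positive_definite n g \<longleftrightarrow> (\<forall>x\<in>real_points n - {\<lambda>_. 0}. eval_poly g x > 0)"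

definition positive_semidefinite :: "nat \<Rightarrow> rpoly \<Rightarrow> bool" where
  "positive_semidefinite n g \<longleftrightarrow> (\<forall>x\<in>real_points n. eval_poly g x \<ge> 0)"

definition sublevel_set :: "nat \<Rightarrow> rpoly \<Rightarrow> real \<Rightarrow> (nat \<Rightarrow> real) set" where
  "sublevel_set n f z = {x \<in> real_points n. eval_poly f x \<le> z}"

definition compact_sublevel_sets :: "nat \<Rightarrow> rpoly \<Rightarrow> bool" where
  "compact_sublevel_sets n f \<longleftrightarrow> (\<forall>z. compactin (Euclidean_space n) (sublevel_set n f z))"

text \<open>The filter of the limit process \<open>\<parallel>x\<parallel> \<rightarrow> \<infinity>\<close> in \<open>\<real>\<^sup>n\<close>, for the Euclidean norm.\<close>

definition norm_at_top :: "nat \<Rightarrow> (nat \<Rightarrow> real) filter" where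
  "norm_at_top n =
     inf (filtercomap (\<lambda>x. L2_set x {..<n}) at_top) (principal (real_points n))"

definition coercive :: "nat \<Rightarrow> rpoly \<Rightarrow> bool" where
  "coercive n f \<longleftrightarrow> Liminf (norm_at_top n) (\<lambda>x. ereal (eval_poly f x)) = \<infinity>"

definition inf_on :: "(nat \<Rightarrow> real) set \<Rightarrow> rpoly \<Rightarrow> ereal" where
  "inf_on A f = (INF x\<in>A. ereal (eval_poly f x))"

definition has_integer_minimizer :: "nat \<Rightarrow> rpoly \<Rightarrow> bool" where
  "has_integer_minimizer n f \<longleftrightarrow>
     (\<exists>x\<in>int_points n. ereal (eval_poly f x) = inf_on (int_points n) f)"

definition has_continuous_minimizer :: "nat \<Rightarrow> rpoly \<Rightarrow> bool" where
  "has_continuous_minimizer n f \<longleftrightarrow>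
     (\<exists>x\<in>real_points n. ereal (eval_poly f x) = inf_on (real_points n) f)"

end

theory Submission
  imports Defs
begin

text \<open>
  The bridge between compactness and growth is that sublevel sets are closed, so by Tychonoff's
  theorem on a box they are compact exactly when they are bounded in norm
  (\<open>compact_iff_norm_bounded\<close>); bounded sublevel sets for all levels are the same as coercivity
  (\<open>compact_sublevel_sets_iff_coercive\<close>). A continuous function with compact sublevel sets attains
  its infimum on every nonempty closed set. Both \<open>\<real>\<^sup>n\<close> and \<open>\<int>\<^sup>n\<close> are closed, so one argument yields both
  kinds of minimizer (\<open>minimizer_on_closed_subset\<close>).

  The implications about the leading form rest on one estimate. Along a ray \<open>r \<mapsto> r u\<close> the polynomial
  becomes \<open>\<Sum>j\<le>d. r ^ j * f\<^sub>j u\<close>, and for \<open>r \<ge> 1\<close> a coefficient \<open>f\<^sub>d u \<ge> c > 0\<close> beats lower coefficients of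
  size at most \<open>C\<close>: the value is at least \<open>c * r - C * d\<close> as soon as this number is nonnegative
  (\<open>linear_lower_bound_for_polynomial\<close>). If the leading form is positive definite, then \<open>c\<close> and \<open>C\<close> can
  be chosen uniformly on the compact unit sphere, which gives coercivity. If the leading form is
  negative somewhere, then it is negative at a point of a fine enough grid \<open>\<int>\<^sup>n / k\<close>, hence by
  homogeneity at an integer point, and the estimate applied to \<open>- f\<close> along the integer multiples of that
  point shows that \<open>f\<close> is unbounded below on \<open>\<int>\<^sup>n\<close>. Finally, a form of odd degree changes sign under
  \<open>x \<mapsto> - x\<close>, so it can be semidefinite only if it vanishes identically, which a nonzero
  polynomial does not do (\<open>eval_poly_nonvanishing\<close>).

  Strictness is witnessed by polynomials in two variables: \<open>x\<^sup>2 + y\<^sup>4\<close> is coercive with leading form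
  \<open>y\<^sup>4\<close>; \<open>x\<^sup>2\<close> has minimizers along a whole line; \<open>(\<surd>2 x - y - 1/2)\<^sup>2\<close> comes arbitrarily close to \<open>0\<close> on
  \<open>\<int>\<^sup>2\<close> but is positive there, since a zero \<open>(p, q)\<close> would satisfy \<open>8 p\<^sup>2 = (2 q + 1)\<^sup>2\<close> against parity;
  \<open>x\<^sup>2 - y\<close> has a semidefinite leading form and is unbounded below; \<open>- x\<^sup>2\<close> has even degree and takes
  negative values; \<open>(x y - 1)\<^sup>2 + x\<^sup>2\<close> has the unattained infimum \<open>0\<close> on \<open>\<real>\<^sup>2\<close>; and \<open>x (x - 1) y\<^sup>2\<close> is
  nonnegative over \<open>\<int>\<^sup>2\<close> and unbounded below on the line \<open>x = 1/2\<close>.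
\<close>

section \<open>Evaluation, degree and leading form\<close>

definition eval_monom :: "monomial \<Rightarrow> (nat \<Rightarrow> real) \<Rightarrow> real" where
  "eval_monom m x = (\<Prod>i\<in>Poly_Mapping.keys m. x i ^ Poly_Mapping.lookup m i)"

lemma eval_poly_eq_sum:
  assumes "finite S" "Poly_Mapping.keys f \<subseteq> S"
  shows "eval_poly f x = (\<Sum>m\<in>S. Poly_Mapping.lookup f m * eval_monom m x)"
  unfolding eval_poly_def eval_monom_def
  by (rule sum.mono_neutral_left) (use assms in \<open>auto simp: in_keys_iff\<close>)

lemma eval_monom_eq_prod:
  assumes "finite S" "Poly_Mapping.keys m \<subseteq> S"
  shows "eval_monom m x = (\<Prod>i\<in>S. x i ^ Poly_Mapping.lookup m i)"
  unfolding eval_monom_def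
  by (rule prod.mono_neutral_left) (use assms in \<open>auto simp: in_keys_iff\<close>)

lemma monom_degree_eq_sum:
  assumes "finite S" "Poly_Mapping.keys m \<subseteq> S"
  shows "monom_degree m = (\<Sum>i\<in>S. Poly_Mapping.lookup m i)"
  unfolding monom_degree_def
  by (rule sum.mono_neutral_left) (use assms in \<open>auto simp: in_keys_iff\<close>)

lemma eval_poly_zero [simp]: "eval_poly 0 x = 0"
  by (simp add: eval_poly_def)

lemma eval_poly_add: "eval_poly (f + g) x = eval_poly f x + eval_poly g x"
proof -
  let ?S = "Poly_Mapping.keys f \<union> Poly_Mapping.keys g"
  have "Poly_Mapping.keys (f + g) \<subseteq> ?S"
    by (rule keys_add)
  then show ?thesis
    by (simp add: eval_poly_eq_sum[of ?S] lookup_add distrib_right sum.distrib)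
qed

lemma eval_poly_sum: "eval_poly (\<Sum>j\<in>A. g j) x = (\<Sum>j\<in>A. eval_poly (g j) x)"
  by (induction A rule: infinite_finite_induct) (auto simp: eval_poly_add)

lemma eval_poly_single: "eval_poly (Poly_Mapping.single m c) x = c * eval_monom m x"
  by (subst eval_poly_eq_sum[of "{m}"]) (auto split: if_splits)

lemma eval_poly_hom_components:
  "eval_poly f x = (\<Sum>j\<le>total_degree f. eval_poly (hom_component j f) x)"
  by (metis eval_poly_sum sum_hom_component)

lemma eval_monom_scale:
  "eval_monom m (\<lambda>i. t * x i) = t ^ monom_degree m * eval_monom m x"
  by (simp add: eval_monom_def monom_degree_def power_mult_distrib prod.distrib power_sum)

lemma eval_poly_homogeneous:
  assumes "homogeneous j g"
  shows "eval_poly g (\<lambda>i. t * x i) = t ^ j * eval_poly g x"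
proof -
  have "Poly_Mapping.lookup g m * eval_monom m (\<lambda>i. t * x i)
      = t ^ j * (Poly_Mapping.lookup g m * eval_monom m x)" if "m \<in> Poly_Mapping.keys g" for m
    using assms that by (simp add: eval_monom_scale homogeneous_def)
  then show ?thesis
    unfolding eval_poly_eq_sum[OF finite_keys order_refl] sum_distrib_left
    by (intro sum.cong) auto
qed

lemma monom_degree_le_total_degree:
  "m \<in> Poly_Mapping.keys f \<Longrightarrow> monom_degree m \<le> total_degree f"
  unfolding total_degree_def by (rule Max_ge) auto

lemma total_degree_attained:
  assumes "total_degree f > 0"
  obtains m where "m \<in> Poly_Mapping.keys f" "monom_degree m = total_degree f"
proof -
  have "total_degree f \<in> insert 0 (monom_degree ` Poly_Mapping.keys f)"
    unfolding total_degree_def by (rule Max_in) auto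
  with assms that show thesis by auto
qed

text \<open>
  In degree \<open>0\<close> the polynomial is homogeneous of degree \<open>0\<close>, and scaling by \<open>t = 0\<close> identifies every
  value with the value at the origin. Two distinct values therefore certify positive degree without a
  computation of the support.
\<close>

lemma total_degree_pos_if_nonconstant:
  assumes "eval_poly f x \<noteq> eval_poly f y"
  shows "total_degree f > 0"
proof (rule ccontr)
  assume "\<not> total_degree f > 0"
  then have "homogeneous 0 f"
    using monom_degree_le_total_degree[of _ f] by (auto simp: homogeneous_def)
  from eval_poly_homogeneous[OF this, of 0] have "eval_poly f (\<lambda>_. 0) = eval_poly f x" for x
    by simp
  with assms show False by metis
qed

text \<open>
  Reads off degree and leading form from a decomposition into a nonzero form and terms of smaller
  degree; nothing in the second summand can cancel against the first.
\<close>

lemma leading_form_add_lower: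
  assumes "homogeneous d g" "g \<noteq> 0" "\<And>m. m \<in> Poly_Mapping.keys h \<Longrightarrow> monom_degree m < d"
  shows "total_degree (g + h) = d" "leading_form (g + h) = g"
proof -
  have h: "Poly_Mapping.lookup h m = 0" if "monom_degree m = d" for m
    using assms(3) that by (auto simp: in_keys_iff)
  have g: "Poly_Mapping.lookup g m = 0" if "monom_degree m \<noteq> d" for m
    using assms(1) that by (auto simp: in_keys_iff homogeneous_def)
  obtain m where m: "m \<in> Poly_Mapping.keys g"
    using assms(2) keys_eq_empty by blast
  with assms(1) have "monom_degree m = d" by (simp add: homogeneous_def)
  with m h have "m \<in> Poly_Mapping.keys (g + h)"
    by (simp add: in_keys_iff lookup_add)
  moreover have "monom_degree k \<le> d" if "k \<in> Poly_Mapping.keys (g + h)" for k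
    using that keys_add[of g h] assms(1,3) by (force simp: homogeneous_def)
  ultimately show deg: "total_degree (g + h) = d"
    unfolding total_degree_def using \<open>monom_degree m = d\<close>
    by (intro Max_eqI) auto
  show "leading_form (g + h) = g"
    unfolding leading_form_def deg
    by (rule poly_mapping_eqI) (auto simp: lookup_hom_component lookup_add h g)
qed

lemma poly_ring_add: "f \<in> poly_ring n \<Longrightarrow> g \<in> poly_ring n \<Longrightarrow> f + g \<in> poly_ring n"
  using keys_add[of f g] by (force simp: poly_ring_def)

lemma poly_ring_leading_form: "f \<in> poly_ring n \<Longrightarrow> leading_form f \<in> poly_ring n"
  by (auto simp: poly_ring_def leading_form_def in_keys_iff lookup_hom_component split: if_splits)

section \<open>Nonzero polynomials are nonzero functions\<close>

text \<open>
  Induction on the number of variables: group the terms by the exponent of the last variable. The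
  group of one occurring exponent is a nonempty sum of the same kind in one variable less, so it is
  nonzero at some point; with that point inserted, the whole sum is a univariate polynomial in the last
  variable with a nonzero coefficient.
\<close>

lemma power_product_sum_nonvanishing:
  fixes c :: "'b \<Rightarrow> real" and e :: "'b \<Rightarrow> nat \<Rightarrow> nat"
  assumes "finite S" "S \<noteq> {}" "\<And>m. m \<in> S \<Longrightarrow> c m \<noteq> 0"
    and "\<And>m m'. m \<in> S \<Longrightarrow> m' \<in> S \<Longrightarrow> \<forall>i<n. e m i = e m' i \<Longrightarrow> m = m'"
  shows "\<exists>x. (\<Sum>m\<in>S. c m * (\<Prod>i<n. x i ^ e m i)) \<noteq> 0"
  using assms
proof (induction n arbitrary: S)
  case 0
  then obtain m where "S = {m}" by auto
  with 0 show ?case by auto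
next
  case (Suc n)
  define T where "T k = {m \<in> S. e m n = k}" for k
  obtain m0 where m0: "m0 \<in> S" using Suc.prems by auto
  define k0 where "k0 = e m0 n"
  have "\<exists>x. (\<Sum>m\<in>T k0. c m * (\<Prod>i<n. x i ^ e m i)) \<noteq> 0"
  proof (rule Suc.IH)
    fix m m' assume "m \<in> T k0" "m' \<in> T k0" "\<forall>i<n. e m i = e m' i"
    then show "m = m'"
      by (intro Suc.prems(4)) (auto simp: T_def less_Suc_eq)
  qed (use m0 Suc.prems in \<open>auto simp: T_def k0_def\<close>)
  then obtain x where x: "(\<Sum>m\<in>T k0. c m * (\<Prod>i<n. x i ^ e m i)) \<noteq> 0" ..
  define a where "a k = (\<Sum>m\<in>T k. c m * (\<Prod>i<n. x i ^ e m i))" for k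
  obtain N where N: "\<And>m. m \<in> S \<Longrightarrow> e m n \<le> N"
    using Suc.prems(1) by (meson finite_imageI finite_nat_set_iff_bounded_le imageI)
  have "k0 \<le> N" using N m0 by (simp add: k0_def)
  with x have "\<not> (\<forall>t. (\<Sum>k\<le>N. a k * t ^ k) = 0)"
    unfolding polyfun_eq_0 by (auto simp: a_def)
  then obtain t where t: "(\<Sum>k\<le>N. a k * t ^ k) \<noteq> 0" by blast
  have "(\<Sum>m\<in>S. c m * (\<Prod>i<Suc n. (x(n := t)) i ^ e m i))
      = (\<Sum>m\<in>S. c m * (\<Prod>i<n. x i ^ e m i) * t ^ e m n)"
    by (intro sum.cong) (auto simp: mult.assoc)
  also have "\<dots> = (\<Sum>k\<le>N. \<Sum>m\<in>T k. c m * (\<Prod>i<n. x i ^ e m i) * t ^ e m n)"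
    unfolding T_def by (rule sum.group[symmetric]) (use Suc.prems(1) N in auto)
  also have "\<dots> = (\<Sum>k\<le>N. a k * t ^ k)"
    unfolding a_def sum_distrib_right by (intro sum.cong) (auto simp: T_def)
  finally show ?case using t by metis
qed

lemma real_points_iff: "x \<in> real_points n \<longleftrightarrow> (\<forall>i\<ge>n. x i = 0)"
  by (simp add: real_points_def topspace_Euclidean_space)

text \<open>
  A nonvanishing point for the sum over monomials is turned into a point of \<open>\<real>\<^sup>n\<close> by setting all
  coordinates from index \<open>n\<close> on to zero; these variables do not occur in the polynomial.
\<close>

lemma eval_poly_nonvanishing:
  assumes "f \<in> poly_ring n" "f \<noteq> 0"
  shows "\<exists>x\<in>real_points n. eval_poly f x \<noteq> 0"
proof -
  have keys: "Poly_Mapping.keys m \<subseteq> {..<n}" if "m \<in> Poly_Mapping.keys f" for m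
    using assms(1) that by (auto simp: poly_ring_def)
  have eval: "eval_poly f x = (\<Sum>m\<in>Poly_Mapping.keys f. Poly_Mapping.lookup f m *
      (\<Prod>i<n. x i ^ Poly_Mapping.lookup m i))" for x
    by (simp add: eval_poly_eq_sum[of "Poly_Mapping.keys f"] eval_monom_eq_prod[OF _ keys])
  have "\<exists>x. (\<Sum>m\<in>Poly_Mapping.keys f. Poly_Mapping.lookup f m *
      (\<Prod>i<n. x i ^ Poly_Mapping.lookup m i)) \<noteq> 0"
  proof (rule power_product_sum_nonvanishing)
    fix m m' assume *: "m \<in> Poly_Mapping.keys f" "m' \<in> Poly_Mapping.keys f"
      "\<forall>i<n. Poly_Mapping.lookup m i = Poly_Mapping.lookup m' i"
    show "m = m'"
    proof (rule poly_mapping_eqI)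
      fix i show "Poly_Mapping.lookup m i = Poly_Mapping.lookup m' i"
      proof (cases "i < n")
        case False
        then have "i \<notin> Poly_Mapping.keys m" "i \<notin> Poly_Mapping.keys m'"
          using keys *(1,2) by blast+
        then show ?thesis by (simp add: in_keys_iff)
      qed (use *(3) in blast)
    qed
  qed (use assms(2) in \<open>auto simp: in_keys_iff\<close>)
  then obtain x where x: "eval_poly f x \<noteq> 0" unfolding eval by blast
  have "eval_poly f (\<lambda>i. if i < n then x i else 0) = eval_poly f x"
    unfolding eval by (intro sum.cong prod.cong arg_cong2[of _ _ _ _ "(*)"]) auto
  with x show ?thesis
    by (intro bexI[of _ "\<lambda>i. if i < n then x i else 0"]) (auto simp: real_points_iff)
qed

section \<open>Compact sublevel sets and coercivity\<close>

lemma zero_mem_int_points: "(\<lambda>_. 0) \<in> int_points n"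
  by (simp add: int_points_def real_points_def topspace_Euclidean_space)

lemma int_points_subset: "int_points n \<subseteq> real_points n"
  by (auto simp: int_points_def)

lemma continuous_on_eval_poly: "continuous_on S (eval_poly f)"
  unfolding eval_poly_def
  by (intro continuous_intros continuous_on_subset[OF continuous_on_product_coordinates]) auto

lemma Euclidean_space_eq: "Euclidean_space n = top_of_set (real_points n)"
  by (simp add: Euclidean_space_def euclidean_product_topology real_points_def)

lemma closed_coordinate_vimage:
  assumes "closed (C :: real set)"
  shows "closed {x :: nat \<Rightarrow> real. x i \<in> C}"
  using closed_vimage[OF assms continuous_on_product_coordinates, of i]
  by (simp add: vimage_def)

lemma closed_real_points: "closed (real_points n)"
proof -
  have "real_points n = (\<Inter>i\<in>{n..}. {x. x i \<in> {0}})"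
    by (auto simp: real_points_iff)
  then show ?thesis
    using closed_coordinate_vimage[of "{0}"] by auto
qed

lemma closed_int_points: "closed (int_points n)"
proof -
  have "int_points n = real_points n \<inter> (\<Inter>i\<in>{..<n}. {x. x i \<in> \<int>})"
    by (auto simp: int_points_def)
  then show ?thesis
    by (auto intro!: closed_Int closed_INT closed_coordinate_vimage closed_real_points)
qed

text \<open>
  For the converse direction a norm bound confines the set to a product of compact intervals, those
  from index \<open>n\<close> on being degenerate; the product is compact by Tychonoff's theorem.
\<close>

lemma compact_iff_norm_bounded:
  assumes "closed K" "K \<subseteq> real_points n"
  shows "compact K \<longleftrightarrow> (\<exists>R. \<forall>x\<in>K. L2_set x {..<n} \<le> R)"
proof
  assume "compact K"
  have "continuous_on K (\<lambda>x. L2_set x {..<n})"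
    unfolding L2_set_def
    by (intro continuous_intros continuous_on_subset[OF continuous_on_product_coordinates]) auto
  from compact_continuous_image[OF this \<open>compact K\<close>]
  have "bounded ((\<lambda>x. L2_set x {..<n}) ` K)"
    by (rule compact_imp_bounded)
  then show "\<exists>R. \<forall>x\<in>K. L2_set x {..<n} \<le> R"
    unfolding bounded_real by fastforce
next
  assume "\<exists>R. \<forall>x\<in>K. L2_set x {..<n} \<le> R"
  then obtain R where R: "\<And>x. x \<in> K \<Longrightarrow> L2_set x {..<n} \<le> R" by auto
  define B where "B = PiE UNIV (\<lambda>i. if i < n then {- R..R} else {0::real})"
  have "compactin (powertop_real UNIV) B"
    unfolding B_def compactin_PiE by auto
  then have "compact B"
    by (simp add: euclidean_product_topology)
  moreover have "K \<subseteq> B"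
  proof
    fix x assume x: "x \<in> K"
    have "\<bar>x i\<bar> \<le> R" if "i < n" for i
    proof -
      have "\<bar>x i\<bar> = L2_set x {i}" by simp
      also have "\<dots> \<le> L2_set x {..<n}"
        unfolding L2_set_def using that by (intro real_sqrt_le_mono sum_mono2) auto
      finally show ?thesis using R[OF x] by simp
    qed
    moreover have "x i = 0" if "i \<ge> n" for i
      using assms(2) x that by (auto simp: real_points_iff)
    ultimately show "x \<in> B"
      by (fastforce simp: B_def abs_le_iff)
  qed
  then have "K = B \<inter> K" by blast
  ultimately show "compact K"
    using compact_Int_closed[OF _ assms(1)] by metis
qed

lemma closed_sublevel_set: "closed (sublevel_set n f z)"
proof -
  have "sublevel_set n f z = real_points n \<inter> eval_poly f -` {..z}"
    by (auto simp: sublevel_set_def)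
  then show ?thesis
    by (auto intro!: closed_Int closed_real_points closed_vimage continuous_on_eval_poly)
qed

lemma compactin_sublevel_set:
  "compactin (Euclidean_space n) (sublevel_set n f z) \<longleftrightarrow> compact (sublevel_set n f z)"
  by (auto simp: Euclidean_space_eq compactin_subtopology sublevel_set_def)

text \<open>
  Tests against real levels suffice for the limit inferior to be \<open>\<infinity>\<close>, since every extended real below
  \<open>\<infinity>\<close> lies below some natural number.
\<close>

lemma coercive_iff:
  "coercive n f \<longleftrightarrow>
     (\<forall>z. \<exists>R. \<forall>x\<in>real_points n. R \<le> L2_set x {..<n} \<longrightarrow> z < eval_poly f x)"
proof -
  have "coercive n f \<longleftrightarrow> \<infinity> \<le> Liminf (norm_at_top n) (\<lambda>x. ereal (eval_poly f x))"
    unfolding coercive_def by simp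
  also have "\<dots> \<longleftrightarrow> (\<forall>y<\<infinity>. \<forall>\<^sub>F x in norm_at_top n. y < ereal (eval_poly f x))"
    by (rule le_Liminf_iff)
  also have "\<dots> \<longleftrightarrow> (\<forall>z. \<forall>\<^sub>F x in norm_at_top n. z < eval_poly f x)" (is "?L \<longleftrightarrow> ?R")
  proof
    assume ?L
    show ?R
    proof
      fix z
      have "ereal z < \<infinity>" by simp
      with \<open>?L\<close> have "\<forall>\<^sub>F x in norm_at_top n. ereal z < ereal (eval_poly f x)" by blast
      then show "\<forall>\<^sub>F x in norm_at_top n. z < eval_poly f x" by simp
    qed
  next
    assume ?R
    show ?L
    proof (intro allI impI)
      fix y :: ereal assume "y < \<infinity>"
      then obtain k :: nat where "y < ereal (real k)"
        using less_PInf_Ex_of_nat by auto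
      moreover from \<open>?R\<close> have "\<forall>\<^sub>F x in norm_at_top n. real k < eval_poly f x" ..
      ultimately show "\<forall>\<^sub>F x in norm_at_top n. y < ereal (eval_poly f x)"
        by (auto elim!: eventually_mono intro: less_trans)
    qed
  qed
  also have "\<dots> \<longleftrightarrow> (\<forall>z. \<exists>R. \<forall>x\<in>real_points n. R \<le> L2_set x {..<n} \<longrightarrow> z < eval_poly f x)"
    unfolding norm_at_top_def eventually_inf_principal eventually_filtercomap_at_top_linorder
    by blast
  finally show ?thesis .
qed

lemma compact_sublevel_sets_iff_coercive: "compact_sublevel_sets n f \<longleftrightarrow> coercive n f"
proof -
  have "compact_sublevel_sets n f \<longleftrightarrow>
      (\<forall>z. \<exists>R. \<forall>x\<in>sublevel_set n f z. L2_set x {..<n} \<le> R)"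
    unfolding compact_sublevel_sets_def compactin_sublevel_set
    by (intro all_cong1 compact_iff_norm_bounded closed_sublevel_set) (auto simp: sublevel_set_def)
  also have "\<dots> \<longleftrightarrow> coercive n f"
    unfolding coercive_iff
  proof (intro all_cong1 iffI)
    fix z assume "\<exists>R. \<forall>x\<in>sublevel_set n f z. L2_set x {..<n} \<le> R"
    then obtain R where R: "\<And>x. x \<in> sublevel_set n f z \<Longrightarrow> L2_set x {..<n} \<le> R" by blast
    show "\<exists>R. \<forall>x\<in>real_points n. R \<le> L2_set x {..<n} \<longrightarrow> z < eval_poly f x"
    proof (intro exI ballI impI)
      fix x assume "x \<in> real_points n" "R + 1 \<le> L2_set x {..<n}"
      then show "z < eval_poly f x" using R[of x] by (force simp: sublevel_set_def)
    qed
  next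
    fix z assume "\<exists>R. \<forall>x\<in>real_points n. R \<le> L2_set x {..<n} \<longrightarrow> z < eval_poly f x"
    then obtain R where
      R: "\<And>x. x \<in> real_points n \<Longrightarrow> R \<le> L2_set x {..<n} \<Longrightarrow> z < eval_poly f x" by blast
    have "L2_set x {..<n} \<le> R" if "x \<in> sublevel_set n f z" for x
      using R[of x] that by (force simp: sublevel_set_def)
    then show "\<exists>R. \<forall>x\<in>sublevel_set n f z. L2_set x {..<n} \<le> R" by blast
  qed
  finally show ?thesis .
qed

text \<open>
  Fix a point \<open>a\<close> of \<open>A\<close>. Outside the sublevel set of level \<open>f a\<close> all values exceed \<open>f a\<close>, so it is enough
  to minimize over the part of \<open>A\<close> inside, which is compact and contains \<open>a\<close>.
\<close>

lemma minimizer_on_closed_subset: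
  assumes "compact_sublevel_sets n f" "closed A" "A \<subseteq> real_points n" "A \<noteq> {}"
  shows "\<exists>x\<in>A. ereal (eval_poly f x) = inf_on A f"
proof -
  obtain a where a: "a \<in> A" using assms by auto
  let ?K = "sublevel_set n f (eval_poly f a) \<inter> A"
  have "compact ?K"
    using assms(1,2) by (auto simp: compact_sublevel_sets_def compactin_sublevel_set)
  moreover have "a \<in> ?K" using a assms(3) by (auto simp: sublevel_set_def)
  ultimately obtain x where x: "x \<in> ?K" "\<And>y. y \<in> ?K \<Longrightarrow> eval_poly f x \<le> eval_poly f y"
    using continuous_attains_inf[OF _ _ continuous_on_eval_poly, of ?K f] by blast
  have "eval_poly f x \<le> eval_poly f y" if "y \<in> A" for y
  proof (cases "eval_poly f y \<le> eval_poly f a")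
    case True
    with that assms(3) x show ?thesis by (auto simp: sublevel_set_def)
  next
    case False
    with x(1) show ?thesis by (auto simp: sublevel_set_def)
  qed
  with x(1) have "inf_on A f = ereal (eval_poly f x)"
    unfolding inf_on_def by (intro INF_eqI) auto
  with x(1) show ?thesis by auto
qed

lemma inf_on_bounded_below_iff:
  "inf_on A f > -\<infinity> \<longleftrightarrow> (\<exists>B. \<forall>x\<in>A. B \<le> eval_poly f x)"
proof
  assume "inf_on A f > -\<infinity>"
  then obtain B where "ereal B < inf_on A f"
    using ereal_dense2 by blast
  then have "ereal B \<le> ereal (eval_poly f x)" if "x \<in> A" for x
    unfolding inf_on_def using that by (meson INF_lower less_imp_le order_trans)
  then show "\<exists>B. \<forall>x\<in>A. B \<le> eval_poly f x" by auto
next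
  assume "\<exists>B. \<forall>x\<in>A. B \<le> eval_poly f x"
  then obtain B where "\<And>x. x \<in> A \<Longrightarrow> B \<le> eval_poly f x" by auto
  then have "ereal B \<le> inf_on A f"
    unfolding inf_on_def by (intro INF_greatest) auto
  then show "inf_on A f > -\<infinity>"
    by (rule less_le_trans[rotated]) simp
qed

lemma inf_on_gt_MInfty_if_attained:
  assumes "ereal (eval_poly f x) = inf_on A f"
  shows "inf_on A f > -\<infinity>"
  by (simp flip: assms)

section \<open>Growth along rays and the leading form\<close>

text \<open>
  The lower terms sum to at least \<open>- C * d * r ^ (d - 1)\<close>, so the whole sum is at least
  \<open>r ^ (d - 1) * (c * r - C * d)\<close>; the last hypothesis makes the second factor nonnegative, and
  \<open>r ^ (d - 1) \<ge> 1\<close>. The bound is uniform in the coefficients, as needed for estimates that hold on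
  the whole unit sphere.
\<close>

lemma linear_lower_bound_for_polynomial:
  fixes a :: "nat \<Rightarrow> real"
  assumes "0 < d" "c \<le> a d" "\<And>j. j < d \<Longrightarrow> \<bar>a j\<bar> \<le> C" "1 \<le> r" "C * d \<le> c * r"
  shows "c * r - C * d \<le> (\<Sum>j\<le>d. r ^ j * a j)"
proof -
  obtain k where d: "d = Suc k" using assms(1) gr0_conv_Suc by auto
  have "C \<ge> 0" using assms(3)[OF assms(1)] by linarith
  have "- (C * r ^ k) \<le> r ^ j * a j" if "j \<le> k" for j
  proof -
    have "\<bar>r ^ j * a j\<bar> \<le> r ^ k * C"
      unfolding abs_mult using that assms(3)[of j] assms(4) d \<open>C \<ge> 0\<close>
      by (intro mult_mono) (auto intro: power_increasing)
    then show ?thesis by (simp add: mult.commute abs_le_iff)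
  qed
  then have "(\<Sum>j\<le>k. - (C * r ^ k)) \<le> (\<Sum>j\<le>k. r ^ j * a j)"
    by (intro sum_mono) auto
  moreover have "(\<Sum>j\<le>k. - (C * r ^ k)) = - (C * d * r ^ k)"
    by (simp add: d algebra_simps)
  moreover have "r ^ d * c \<le> r ^ d * a d"
    using assms(2,4) by (intro mult_left_mono) auto
  moreover have "1 * (c * r - C * d) \<le> r ^ k * (c * r - C * d)"
    using assms(4,5) by (intro mult_right_mono) (auto intro: one_le_power)
  ultimately show ?thesis by (simp add: d algebra_simps)
qed

lemma eval_poly_scale:
  "eval_poly f (\<lambda>i. t * x i) = (\<Sum>j\<le>total_degree f. t ^ j * eval_poly (hom_component j f) x)"
  by (subst eval_poly_hom_components)
    (simp add: eval_poly_homogeneous[OF homogeneous_hom_component])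

text \<open>
  Write \<open>x = r u\<close> with \<open>u\<close> on the unit sphere. By compactness the leading form has a positive minimum
  \<open>c\<close> there, and the lower forms are bounded by some \<open>C\<close>; the growth estimate then applies with these
  constants to all directions at once.
\<close>

lemma coercive_if_positive_definite:
  assumes "n \<ge> 1" "total_degree f > 0" "positive_definite n (leading_form f)"
  shows "coercive n f"
  unfolding coercive_iff
proof
  fix z
  define d where "d = total_degree f"
  define S where "S = {x \<in> real_points n. L2_set x {..<n} = 1}"
  have cont: "continuous_on UNIV (\<lambda>x :: nat \<Rightarrow> real. L2_set x {..<n})"
    unfolding L2_set_def by (intro continuous_intros continuous_on_product_coordinates)
  have "S = real_points n \<inter> (\<lambda>x. L2_set x {..<n}) -` {1}" by (auto simp: S_def)
  then have "closed S"
    by (auto intro!: closed_Int closed_real_points closed_vimage cont)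
  then have "compact S"
    by (subst compact_iff_norm_bounded) (auto simp: S_def)
  have "L2_set (\<lambda>i. if i = 0 then 1 else 0) {..<n} = 1"
    using assms(1) by (simp add: L2_set_def if_distrib[of "\<lambda>y. y ^ 2"] cong: if_cong)
  with assms(1) have "(\<lambda>i. if i = 0 then 1 else 0) \<in> S"
    by (auto simp: S_def real_points_iff)
  then have "S \<noteq> {}" by auto
  obtain u0 where u0: "u0 \<in> S" "\<And>u. u \<in> S \<Longrightarrow> eval_poly (leading_form f) u0 \<le> eval_poly (leading_form f) u"
    using continuous_attains_inf[OF \<open>compact S\<close> \<open>S \<noteq> {}\<close> continuous_on_eval_poly] by blast
  define c where "c = eval_poly (leading_form f) u0"
  have "u0 \<noteq> (\<lambda>_. 0)" using u0(1) by (auto simp: S_def L2_set_def)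
  then have "c > 0"
    using assms(3) u0(1) by (auto simp: c_def positive_definite_def S_def)
  have "continuous_on S (\<lambda>u. \<Sum>j<d. \<bar>eval_poly (hom_component j f) u\<bar>)"
    by (intro continuous_intros continuous_on_eval_poly)
  from compact_imp_bounded[OF compact_continuous_image[OF this \<open>compact S\<close>]]
  obtain C where C: "\<And>u. u \<in> S \<Longrightarrow> \<bar>\<Sum>j<d. \<bar>eval_poly (hom_component j f) u\<bar>\<bar> \<le> C"
    unfolding bounded_real by blast
  have lower: "\<bar>eval_poly (hom_component j f) u\<bar> \<le> C" if "u \<in> S" "j < d" for u j
  proof -
    have "\<bar>eval_poly (hom_component j f) u\<bar> \<le> (\<Sum>j<d. \<bar>eval_poly (hom_component j f) u\<bar>)"
      using that by (intro member_le_sum) auto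
    with C[OF that(1)] show ?thesis by linarith
  qed
  \<comment> \<open>\<open>R\<close> is chosen such that \<open>r \<ge> R\<close> forces \<open>c * r - C * d > \<bar>z\<bar>\<close>\<close>
  define R where "R = max 1 ((\<bar>z\<bar> + C * d) / c + 1)"
  have "z < eval_poly f x" if x: "x \<in> real_points n" "R \<le> L2_set x {..<n}" for x
  proof -
    define r where "r = L2_set x {..<n}"
    have r: "1 \<le> r" "(\<bar>z\<bar> + C * d) / c + 1 \<le> r" using x(2) by (auto simp: r_def R_def)
    from r(2) have "(\<bar>z\<bar> + C * d) / c < r" by linarith
    with \<open>c > 0\<close> have big: "\<bar>z\<bar> + C * d < c * r"
      by (simp add: divide_simps mult.commute)
    define u where "u = (\<lambda>i. 1 / r * x i)"
    have "L2_set u {..<n} = 1"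
      unfolding u_def using r(1) by (subst L2_set_right_distrib[symmetric]) (auto simp: r_def)
    with x(1) have u: "u \<in> S" by (auto simp: S_def u_def real_points_iff)
    have "c * r - C * d \<le> (\<Sum>j\<le>d. r ^ j * eval_poly (hom_component j f) u)"
      using assms(2) u0(2)[OF u] lower[OF u] r(1) big
      by (intro linear_lower_bound_for_polynomial) (auto simp: d_def c_def leading_form_def)
    also have "\<dots> = eval_poly f (\<lambda>i. r * u i)"
      by (simp add: eval_poly_scale d_def)
    also have "(\<lambda>i. r * u i) = x" using r(1) by (auto simp: u_def)
    finally show ?thesis using big by linarith
  qed
  then show "\<exists>R. \<forall>x\<in>real_points n. R \<le> L2_set x {..<n} \<longrightarrow> z < eval_poly f x" by blast
qed

text \<open>
  The growth estimate for \<open>- f\<close>. The multipliers are natural numbers so that the ray through an integer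
  point is followed along integer points.
\<close>

lemma unbounded_below_along_negative_ray:
  assumes "total_degree f > 0" "eval_poly (leading_form f) x < 0"
  shows "\<exists>k::nat. eval_poly f (\<lambda>i. real k * x i) < B"
proof -
  define d where "d = total_degree f"
  define a where "a j = - eval_poly (hom_component j f) x" for j
  define C where "C = (\<Sum>j<d. \<bar>a j\<bar>)"
  have "a d > 0" using assms(2) by (simp add: a_def d_def leading_form_def)
  obtain k :: nat where k: "max 1 ((\<bar>B\<bar> + C * d) / a d + 1) \<le> k"
    using real_arch_simple by blast
  then have "(\<bar>B\<bar> + C * d) / a d < k" by simp
  with \<open>a d > 0\<close> have big: "\<bar>B\<bar> + C * d < a d * k"
    by (simp add: divide_simps mult.commute)
  have "\<bar>a j\<bar> \<le> C" if "j < d" for j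
    unfolding C_def using that by (intro member_le_sum) auto
  then have "a d * real k - C * d \<le> (\<Sum>j\<le>d. real k ^ j * a j)"
    using assms(1) big k by (intro linear_lower_bound_for_polynomial) (auto simp: d_def)
  also have "\<dots> = - eval_poly f (\<lambda>i. real k * x i)"
    by (simp add: eval_poly_scale a_def d_def sum_negf)
  finally have "eval_poly f (\<lambda>i. real k * x i) < B" using big by linarith
  then show ?thesis ..
qed

lemma floor_scaled_tendsto: "(\<lambda>k. of_int \<lfloor>real k * t\<rfloor> / real k) \<longlonglongrightarrow> t"
proof (rule tendsto_sandwich)
  show "\<forall>\<^sub>F k in sequentially. t - inverse (real k) \<le> of_int \<lfloor>real k * t\<rfloor> / real k"
    using eventually_gt_at_top[of 0]
  proof eventually_elim
    case (elim k)
    have "real k * t - 1 \<le> of_int \<lfloor>real k * t\<rfloor>" by linarith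
    then have "(real k * t - 1) / real k \<le> of_int \<lfloor>real k * t\<rfloor> / real k"
      by (rule divide_right_mono) simp
    with elim show ?case by (simp add: diff_divide_distrib inverse_eq_divide)
  qed
  show "\<forall>\<^sub>F k in sequentially. of_int \<lfloor>real k * t\<rfloor> / real k \<le> t"
    using eventually_gt_at_top[of 0]
  proof eventually_elim
    case (elim k)
    have "of_int \<lfloor>real k * t\<rfloor> \<le> real k * t" by linarith
    with elim show ?case by (simp add: field_simps)
  qed
  show "(\<lambda>k. t - inverse (real k)) \<longlonglongrightarrow> t"
    using tendsto_diff[OF tendsto_const lim_inverse_n] by simp
qed simp

text \<open>
  The points with coordinates \<open>\<lfloor>k x\<^sub>i\<rfloor> / k\<close> converge to \<open>x\<close>, so the form is eventually negative on them.
  Multiplication by \<open>k\<close> clears all denominators and keeps the sign by homogeneity.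
\<close>

lemma negative_integer_point:
  assumes "homogeneous d g" "x \<in> real_points n" "eval_poly g x < 0"
  shows "\<exists>y\<in>int_points n. eval_poly g y < 0"
proof -
  define y where "y k i = (of_int \<lfloor>real k * x i\<rfloor> :: real)" for k i
  have "(\<lambda>k. eval_poly g (\<lambda>i. y k i / real k)) \<longlonglongrightarrow> eval_poly g x"
    unfolding eval_poly_def y_def by (intro tendsto_intros floor_scaled_tendsto)
  then have "\<forall>\<^sub>F k in sequentially. eval_poly g (\<lambda>i. y k i / real k) < 0"
    using assms(3) by (rule order_tendstoD)
  with eventually_gt_at_top[of 0]
  have "\<forall>\<^sub>F k in sequentially. eval_poly g (y k) < 0"
  proof eventually_elim
    case (elim k)
    have "eval_poly g (y k) = eval_poly g (\<lambda>i. real k * (y k i / real k))"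
      using elim(1) by simp
    also have "\<dots> = real k ^ d * eval_poly g (\<lambda>i. y k i / real k)"
      by (rule eval_poly_homogeneous[OF assms(1)])
    also have "\<dots> < 0"
      using elim by (simp add: mult_less_0_iff)
    finally show ?case .
  qed
  then obtain k where "eval_poly g (y k) < 0"
    using eventually_happens by fastforce
  moreover have "y k \<in> int_points n"
    using assms(2) by (auto simp: int_points_def real_points_iff y_def)
  ultimately show ?thesis by blast
qed

lemma positive_semidefinite_if_bounded_below:
  assumes "total_degree f > 0" "inf_on (int_points n) f > -\<infinity>"
  shows "positive_semidefinite n (leading_form f)"
proof (rule ccontr)
  assume "\<not> positive_semidefinite n (leading_form f)"
  then obtain x where "x \<in> int_points n" and neg: "eval_poly (leading_form f) x < 0"
    using negative_integer_point[OF homogeneous_hom_component]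
    unfolding positive_semidefinite_def leading_form_def by (meson not_le)
  then have mult: "(\<lambda>i. real k * x i) \<in> int_points n" for k
    by (auto simp: int_points_def real_points_iff)
  from assms(2) obtain B where "\<And>y. y \<in> int_points n \<Longrightarrow> B \<le> eval_poly f y"
    unfolding inf_on_bounded_below_iff by blast
  with mult unbounded_below_along_negative_ray[OF assms(1) neg, of B] show False
    by (meson not_le)
qed

lemma even_degree_if_positive_semidefinite:
  assumes "f \<in> poly_ring n" "total_degree f > 0" "positive_semidefinite n (leading_form f)"
  shows "even (total_degree f)"
proof (rule ccontr)
  assume odd: "odd (total_degree f)"
  obtain m where m: "m \<in> Poly_Mapping.keys f" "monom_degree m = total_degree f"
    using total_degree_attained[OF assms(2)] .
  then have "leading_form f \<noteq> 0"
    by (metis in_keys_iff leading_form_def lookup_hom_component lookup_zero)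
  with assms(1) obtain x where x: "x \<in> real_points n" "eval_poly (leading_form f) x \<noteq> 0"
    using eval_poly_nonvanishing[OF poly_ring_leading_form] by blast
  have "eval_poly (leading_form f) (\<lambda>i. - 1 * x i) = - eval_poly (leading_form f) x"
    unfolding leading_form_def
    by (subst eval_poly_homogeneous[OF homogeneous_hom_component]) (simp add: odd)
  moreover have "(\<lambda>i. - 1 * x i) \<in> real_points n" using x(1) by (simp add: real_points_iff)
  ultimately have "0 \<le> - eval_poly (leading_form f) x" "0 \<le> eval_poly (leading_form f) x"
    using assms(3) x(1) unfolding positive_semidefinite_def by metis+
  with x(2) show False by simp
qed

section \<open>Polynomials in two variables\<close>

definition xy_term :: "real \<Rightarrow> nat \<Rightarrow> nat \<Rightarrow> rpoly" where
  "xy_term c a b = Poly_Mapping.single (Poly_Mapping.single 0 a + Poly_Mapping.single 1 b) c"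

definition xy_point :: "real \<Rightarrow> real \<Rightarrow> nat \<Rightarrow> real" where
  "xy_point s t = (\<lambda>_. 0)(0 := s, 1 := t)"

lemma xy_point_simps [simp]: "xy_point s t 0 = s" "xy_point s t (Suc 0) = t"
  by (auto simp: xy_point_def)

lemma xy_point_in_real_points: "xy_point s t \<in> real_points 2"
  by (auto simp: xy_point_def real_points_iff)

lemma xy_point_in_int_points: "s \<in> \<int> \<Longrightarrow> t \<in> \<int> \<Longrightarrow> xy_point s t \<in> int_points 2"
  using xy_point_in_real_points by (auto simp: int_points_def less_2_cases_iff)

lemma int_points_coordinates: "x \<in> int_points 2 \<Longrightarrow> x 0 \<in> \<int> \<and> x (Suc 0) \<in> \<int>"
  by (auto simp: int_points_def)

lemma keys_xy_monomial:
  "Poly_Mapping.keys (Poly_Mapping.single 0 a + Poly_Mapping.single 1 b :: monomial) \<subseteq> {0, 1}"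
  using keys_add[of "Poly_Mapping.single 0 a" "Poly_Mapping.single (1::nat) b"]
  by (auto split: if_splits)

lemma eval_xy_term [simp]: "eval_poly (xy_term c a b) x = c * x 0 ^ a * x (Suc 0) ^ b"
  unfolding xy_term_def eval_poly_single
  by (subst eval_monom_eq_prod[OF _ keys_xy_monomial]) (auto simp: lookup_add lookup_single)

lemma monom_degree_xy:
  "monom_degree (Poly_Mapping.single 0 a + Poly_Mapping.single 1 b) = a + b"
  by (subst monom_degree_eq_sum[OF _ keys_xy_monomial]) (auto simp: lookup_add lookup_single)

lemma monom_degree_keys_xy_term:
  "m \<in> Poly_Mapping.keys (xy_term c a b) \<Longrightarrow> monom_degree m = a + b"
  using monom_degree_xy[of a b] by (auto simp: xy_term_def split: if_splits)

lemma xy_term_eq_0_iff: "xy_term c a b = 0 \<longleftrightarrow> c = 0"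
  by (metis lookup_single_eq lookup_zero single_zero xy_term_def)

lemma xy_term_in_poly_ring: "xy_term c a b \<in> poly_ring 2"
  using keys_xy_monomial[of a b] by (auto simp: poly_ring_def xy_term_def split: if_splits)

lemmas poly_ring_2_intros = poly_ring_add xy_term_in_poly_ring

lemma leading_form_xy_term_add:
  assumes "c \<noteq> 0" "a' + b' < a + b"
  shows "leading_form (xy_term c a b + xy_term c' a' b') = xy_term c a b"
  by (rule leading_form_add_lower(2)[of "a + b"])
    (use assms in \<open>auto simp: homogeneous_def xy_term_eq_0_iff monom_degree_keys_xy_term\<close>)

lemma leading_form_xy_term:
  assumes "c \<noteq> 0"
  shows "leading_form (xy_term c a b) = xy_term c a b" "total_degree (xy_term c a b) = a + b"
  using leading_form_add_lower[of "a + b" "xy_term c a b" 0] assms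
  by (auto simp: homogeneous_def xy_term_eq_0_iff monom_degree_keys_xy_term)

section \<open>Counterexamples to the converses\<close>

lemma compact_not_imp_positive_definite:
  "\<exists>n f. n \<ge> 1 \<and> f \<in> poly_ring n \<and> total_degree f > 0 \<and>
     compact_sublevel_sets n f \<and> \<not> positive_definite n (leading_form f)"
proof -
  define f where "f = xy_term 1 0 4 + xy_term 1 2 0"
  have eval: "eval_poly f x = x 1 ^ 4 + x 0 ^ 2" for x
    by (simp add: f_def eval_poly_add)
  have "f \<in> poly_ring 2" unfolding f_def by (intro poly_ring_2_intros)
  moreover have "total_degree f > 0"
    by (rule total_degree_pos_if_nonconstant[of _ "xy_point 0 0" "xy_point 1 0"]) (simp add: eval)
  moreover have "compact_sublevel_sets 2 f"
    unfolding compact_sublevel_sets_iff_coercive coercive_iff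
  proof (intro allI exI ballI impI)
    fix z x assume x: "x \<in> real_points 2" "\<bar>z\<bar> + 2 \<le> L2_set x {..<2}"
    have "(\<bar>z\<bar> + 2) ^ 2 \<le> L2_set x {..<2} ^ 2" using x(2) by (intro power_mono) auto
    also have "\<dots> = x 0 ^ 2 + x 1 ^ 2"
      by (simp add: L2_set_def numeral_2_eq_2 lessThan_Suc)
    also have "\<dots> \<le> eval_poly f x + 1"
    proof -
      \<comment> \<open>with \<open>y = x 1\<close> this is \<open>y\<^sup>2 \<le> y\<^sup>4 + 1\<close>\<close>
      have "0 \<le> (x 1 ^ 2 - 1) ^ 2 + (x 1 ^ 2)" by simp
      then show ?thesis by (simp add: eval power2_diff flip: power_mult)
    qed
    finally have "(\<bar>z\<bar> + 2) ^ 2 \<le> eval_poly f x + 1" .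
    moreover have "(\<bar>z\<bar> + 2) ^ 2 = \<bar>z\<bar> ^ 2 + 4 * \<bar>z\<bar> + 4"
      by (simp add: power2_eq_square algebra_simps)
    moreover have "0 \<le> \<bar>z\<bar> ^ 2" by simp
    ultimately show "z < eval_poly f x" by linarith
  qed
  moreover have "\<not> positive_definite 2 (leading_form f)"
  proof -
    have "xy_point 1 0 \<noteq> (\<lambda>_. 0)" by (metis xy_point_simps(1) zero_neq_one)
    moreover have "leading_form f = xy_term 1 0 4"
      unfolding f_def by (rule leading_form_xy_term_add) auto
    ultimately show ?thesis
      using xy_point_in_real_points[of 1 0]
      by (auto simp: positive_definite_def intro!: bexI[of _ "xy_point 1 0"])
  qed
  ultimately show ?thesis by (intro exI[of _ 2] exI[of _ f]) auto
qed

lemma minimizers_not_imp_coercive: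
  "\<exists>n f. n \<ge> 1 \<and> f \<in> poly_ring n \<and> total_degree f > 0 \<and>
     has_integer_minimizer n f \<and> has_continuous_minimizer n f \<and> \<not> coercive n f"
proof -
  define f where "f = xy_term 1 2 0"
  have eval: "eval_poly f x = x 0 ^ 2" for x
    by (simp add: f_def)
  have "f \<in> poly_ring 2" unfolding f_def by (intro poly_ring_2_intros)
  moreover have "total_degree f > 0"
    by (rule total_degree_pos_if_nonconstant[of _ "xy_point 0 0" "xy_point 1 0"]) (simp add: eval)
  moreover have min: "\<exists>x\<in>A. ereal (eval_poly f x) = inf_on A f" if "(\<lambda>_. 0) \<in> A" for A
  proof -
    have "inf_on A f = ereal (eval_poly f (\<lambda>_. 0))"
      unfolding inf_on_def
    proof (rule INF_eqI)
      show "y \<le> ereal (eval_poly f (\<lambda>_. 0))"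
        if "\<And>x. x \<in> A \<Longrightarrow> y \<le> ereal (eval_poly f x)" for y
        using that \<open>(\<lambda>_. 0) \<in> A\<close> by blast
    qed (simp add: eval)
    with that show ?thesis by force
  qed
  moreover have "\<not> coercive 2 f"
  proof
    assume "coercive 2 f"
    then obtain R where R: "\<And>x. x \<in> real_points 2 \<Longrightarrow> R \<le> L2_set x {..<2} \<Longrightarrow> 0 < eval_poly f x"
      unfolding coercive_iff by meson
    have "L2_set (xy_point 0 \<bar>R\<bar>) {..<2} = \<bar>R\<bar>"
      by (simp add: L2_set_def numeral_2_eq_2 lessThan_Suc)
    with R[OF xy_point_in_real_points, of 0 "\<bar>R\<bar>"] show False
      by (simp add: eval abs_ge_self)
  qed
  ultimately show ?thesis
    using min[OF zero_mem_int_points] min[of "real_points 2"]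
    by (intro exI[of _ 2] exI[of _ f])
      (auto simp: has_integer_minimizer_def has_continuous_minimizer_def real_points_iff)
qed

lemma integer_minimizer_not_imp_compact:
  "\<exists>n f. n \<ge> 1 \<and> f \<in> poly_ring n \<and> total_degree f > 0 \<and>
     has_integer_minimizer n f \<and> \<not> compact_sublevel_sets n f"
  using minimizers_not_imp_coercive unfolding compact_sublevel_sets_iff_coercive by blast

lemma continuous_minimizer_not_imp_coercive:
  "\<exists>n f. n \<ge> 1 \<and> f \<in> poly_ring n \<and> total_degree f > 0 \<and>
     has_continuous_minimizer n f \<and> \<not> coercive n f"
  using minimizers_not_imp_coercive by blast

text \<open>
  Powers of the unit \<open>3 - 2\<surd>2\<close> of \<open>\<int>[\<surd>2]\<close> have odd rational part and even coefficient of \<open>\<surd>2\<close>. As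
  they tend to zero, half of them give integers \<open>a\<close>, \<open>b\<close> for which \<open>\<surd>2 a\<close> is as close as desired to
  \<open>b + 1/2\<close>.
\<close>

lemma sqrt2_half_integer_approximation:
  "\<exists>a b :: int. 2 * of_int b + 1 - 2 * of_int a * sqrt 2 = (3 - 2 * sqrt 2) ^ k"
proof (induction k)
  case 0
  show ?case by (intro exI[of _ 0]) simp
next
  case (Suc k)
  then obtain a b :: int where ab: "2 * of_int b + 1 - 2 * of_int a * sqrt 2 = (3 - 2 * sqrt 2) ^ k" by blast
  have "2 * of_int (3 * b + 4 * a + 1) + 1 - 2 * of_int (3 * a + 2 * b + 1) * sqrt 2
      = (3 - 2 * sqrt 2) * (2 * of_int b + 1 - 2 * of_int a * sqrt 2)"
    by (simp add: algebra_simps)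
  also have "\<dots> = (3 - 2 * sqrt 2) ^ Suc k" by (simp add: ab)
  finally show ?case by blast
qed

lemma bounded_below_not_imp_integer_minimizer:
  "\<exists>n f. n \<ge> 1 \<and> f \<in> poly_ring n \<and> total_degree f > 0 \<and>
     inf_on (int_points n) f > -\<infinity> \<and> \<not> has_integer_minimizer n f"
proof -
  define f where "f = xy_term 2 2 0 + xy_term (- 2 * sqrt 2) 1 1 + xy_term 1 0 2
    + xy_term (- sqrt 2) 1 0 + xy_term 1 0 1 + xy_term (1 / 4) 0 0"
  have eval: "eval_poly f x = (sqrt 2 * x 0 - x 1 - 1 / 2) ^ 2" for x
    by (simp add: f_def eval_poly_add power2_eq_square algebra_simps)
  have "f \<in> poly_ring 2" unfolding f_def by (intro poly_ring_2_intros)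
  moreover have "total_degree f > 0"
    by (rule total_degree_pos_if_nonconstant[of _ "xy_point 0 0" "xy_point 0 1"])
      (simp add: eval power2_eq_square)
  moreover have "inf_on (int_points 2) f > -\<infinity>"
    unfolding inf_on_bounded_below_iff by (auto simp: eval intro!: exI[of _ 0])
  moreover have "\<not> has_integer_minimizer 2 f"
  proof
    assume "has_integer_minimizer 2 f"
    then obtain x where x: "x \<in> int_points 2" "ereal (eval_poly f x) = inf_on (int_points 2) f"
      by (auto simp: has_integer_minimizer_def)
    have le: "eval_poly f x \<le> eval_poly f y" if "y \<in> int_points 2" for y
    proof -
      have "ereal (eval_poly f x) \<le> ereal (eval_poly f y)"
        unfolding x(2) inf_on_def using that by (rule INF_lower)
      then show ?thesis by simp
    qed
    have "1 < sqrt 2" "sqrt 2 < 3 / 2"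
      by (simp, rule real_less_lsqrt) (auto simp: power2_eq_square)
    then have q: "0 \<le> 3 - 2 * sqrt 2" "3 - 2 * sqrt 2 < 1" by simp_all
    have le_k: "eval_poly f x \<le> ((3 - 2 * sqrt 2) ^ k / 2) ^ 2" for k
    proof -
      obtain a b :: int where ab: "2 * of_int b + 1 - 2 * of_int a * sqrt 2 = (3 - 2 * sqrt 2) ^ k"
        using sqrt2_half_integer_approximation by blast
      have "eval_poly f (xy_point (of_int a) (of_int b))
          = ((2 * of_int b + 1 - 2 * of_int a * sqrt 2) / 2) ^ 2"
        by (simp add: eval power2_eq_square field_simps)
      then show ?thesis
        using le[OF xy_point_in_int_points, of "of_int a" "of_int b"] ab by simp
    qed
    have lim: "(\<lambda>k. ((3 - 2 * sqrt 2) ^ k / 2) ^ 2) \<longlonglongrightarrow> (0 / 2) ^ 2"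
      using q by (intro tendsto_intros LIMSEQ_realpow_zero) auto
    have "eval_poly f x \<le> (0 / 2) ^ 2"
      by (rule LIMSEQ_le_const[OF lim]) (use le_k in blast)
    then have eq: "sqrt 2 * x 0 = x 1 + 1 / 2"
      by (simp add: eval)
    from int_points_coordinates[OF x(1)] obtain p q :: int where pq: "x 0 = of_int p" "x 1 = of_int q"
      by (auto elim!: Ints_cases)
    have "8 * (of_int p)\<^sup>2 = (2 * (sqrt 2 * of_int p))\<^sup>2"
      by (simp add: power_mult_distrib)
    also have "\<dots> = (2 * of_int q + 1)\<^sup>2"
      using eq pq by simp
    finally have "real_of_int (8 * p\<^sup>2) = real_of_int ((2 * q + 1)\<^sup>2)" by simp
    then have "8 * p\<^sup>2 = (2 * q + 1)\<^sup>2" by (simp only: of_int_eq_iff)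
    then have "even ((2 * q + 1)\<^sup>2)" by (metis dvd_mult2 even_numeral)
    then show False by simp
  qed
  ultimately show ?thesis by (intro exI[of _ 2] exI[of _ f]) auto
qed

lemma positive_semidefinite_not_imp_bounded_below:
  "\<exists>n f. n \<ge> 1 \<and> f \<in> poly_ring n \<and> total_degree f > 0 \<and>
     positive_semidefinite n (leading_form f) \<and> \<not> inf_on (int_points n) f > -\<infinity>"
proof -
  define f where "f = xy_term 1 2 0 + xy_term (-1) 0 1"
  have eval: "eval_poly f x = x 0 ^ 2 - x 1" for x
    by (simp add: f_def eval_poly_add)
  have "f \<in> poly_ring 2" unfolding f_def by (intro poly_ring_2_intros)
  moreover have "total_degree f > 0"
    by (rule total_degree_pos_if_nonconstant[of _ "xy_point 0 0" "xy_point 1 0"]) (simp add: eval)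
  moreover have "positive_semidefinite 2 (leading_form f)"
    unfolding f_def by (subst leading_form_xy_term_add) (auto simp: positive_semidefinite_def)
  moreover have "\<not> inf_on (int_points 2) f > -\<infinity>"
    unfolding inf_on_bounded_below_iff
  proof
    assume "\<exists>B. \<forall>x\<in>int_points 2. B \<le> eval_poly f x"
    then obtain B where B: "\<And>x. x \<in> int_points 2 \<Longrightarrow> B \<le> eval_poly f x" by auto
    obtain k :: nat where "- B < k" using reals_Archimedean2 by blast
    with B[OF xy_point_in_int_points, of 0 "real k"] show False by (simp add: eval)
  qed
  ultimately show ?thesis by (intro exI[of _ 2] exI[of _ f]) auto
qed

lemma even_degree_not_imp_positive_semidefinite:
  "\<exists>n f. n \<ge> 1 \<and> f \<in> poly_ring n \<and> total_degree f > 0 \<and>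
     even (total_degree f) \<and> \<not> positive_semidefinite n (leading_form f)"
proof -
  have "\<not> positive_semidefinite 2 (xy_term (-1) 2 0)"
    using xy_point_in_real_points[of 1 0]
    by (auto simp: positive_semidefinite_def intro!: bexI[of _ "xy_point 1 0"])
  then show ?thesis
    using leading_form_xy_term[of "-1" 2 0] xy_term_in_poly_ring[of "-1" 2 0]
    by (intro exI[of _ 2] exI[of _ "xy_term (-1) 2 0"]) auto
qed

lemma bounded_below_not_imp_continuous_minimizer:
  "\<exists>n f. n \<ge> 1 \<and> f \<in> poly_ring n \<and> total_degree f > 0 \<and>
     inf_on (real_points n) f > -\<infinity> \<and> \<not> has_continuous_minimizer n f"
proof -
  define f where "f = xy_term 1 2 2 + xy_term (-2) 1 1 + xy_term 1 0 0 + xy_term 1 2 0"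
  have eval: "eval_poly f x = (x 0 * x 1 - 1) ^ 2 + x 0 ^ 2" for x
    by (simp add: f_def eval_poly_add power2_eq_square algebra_simps)
  have "f \<in> poly_ring 2" unfolding f_def by (intro poly_ring_2_intros)
  moreover have "total_degree f > 0"
    by (rule total_degree_pos_if_nonconstant[of _ "xy_point 0 0" "xy_point 1 0"]) (simp add: eval)
  moreover have "inf_on (real_points 2) f > -\<infinity>"
    unfolding inf_on_bounded_below_iff by (auto simp: eval intro!: exI[of _ 0])
  moreover have "\<not> has_continuous_minimizer 2 f"
  proof
    assume "has_continuous_minimizer 2 f"
    then obtain x where x: "ereal (eval_poly f x) = inf_on (real_points 2) f"
      by (auto simp: has_continuous_minimizer_def)
    have le_k: "eval_poly f x \<le> inverse (real (Suc k)) ^ 2" for k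
    proof -
      \<comment> \<open>on the hyperbola \<open>x y = 1\<close> the first square vanishes\<close>
      let ?y = "xy_point (inverse (real (Suc k))) (real (Suc k))"
      have "ereal (eval_poly f x) \<le> ereal (eval_poly f ?y)"
        unfolding x inf_on_def using xy_point_in_real_points by (rule INF_lower)
      then show ?thesis by (simp add: eval)
    qed
    have lim: "(\<lambda>k. inverse (real (Suc k)) ^ 2) \<longlonglongrightarrow> 0 ^ 2"
      by (intro tendsto_intros LIMSEQ_inverse_real_of_nat)
    have "eval_poly f x \<le> 0 ^ 2"
      by (rule LIMSEQ_le_const[OF lim]) (use le_k in blast)
    then show False
      by (auto simp: eval sum_power2_le_zero_iff)
  qed
  ultimately show ?thesis by (intro exI[of _ 2] exI[of _ f]) auto
qed

lemma integer_bounded_below_not_imp_bounded_below: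
  "\<exists>n f. n \<ge> 1 \<and> f \<in> poly_ring n \<and> total_degree f > 0 \<and>
     inf_on (int_points n) f > -\<infinity> \<and> \<not> inf_on (real_points n) f > -\<infinity>"
proof -
  define f where "f = xy_term 1 2 2 + xy_term (-1) 1 2"
  have eval: "eval_poly f x = x 0 * (x 0 - 1) * x 1 ^ 2" for x
    by (simp add: f_def eval_poly_add power2_eq_square algebra_simps)
  have "f \<in> poly_ring 2" unfolding f_def by (intro poly_ring_2_intros)
  moreover have "total_degree f > 0"
    by (rule total_degree_pos_if_nonconstant[of _ "xy_point 0 0" "xy_point 2 1"]) (simp add: eval)
  moreover have nonneg: "0 \<le> eval_poly f x" if "x \<in> int_points 2" for x
  proof -
    from int_points_coordinates[OF that] obtain p :: int where p: "x 0 = of_int p"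
      by (auto elim!: Ints_cases)
    have "p \<le> 0 \<or> p \<ge> 1" by linarith
    then have "0 \<le> p * (p - 1)" by (auto intro: mult_nonpos_nonpos)
    then have "0 \<le> real_of_int (p * (p - 1))" by (simp only: of_int_0_le_iff)
    then have "0 \<le> x 0 * (x 0 - 1)" by (simp add: p)
    then show ?thesis unfolding eval by (rule mult_nonneg_nonneg) simp
  qed
  then have "inf_on (int_points 2) f > -\<infinity>"
    unfolding inf_on_bounded_below_iff by blast
  moreover have "\<not> inf_on (real_points 2) f > -\<infinity>"
    unfolding inf_on_bounded_below_iff
  proof
    assume "\<exists>B. \<forall>x\<in>real_points 2. B \<le> eval_poly f x"
    then obtain B where B: "\<And>x. x \<in> real_points 2 \<Longrightarrow> B \<le> eval_poly f x" by auto
    \<comment> \<open>at \<open>(1/2, t)\<close> the value is \<open>- t\<^sup>2 / 4 \<le> - t\<close> once \<open>t \<ge> 4\<close>\<close>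
    define t where "t = \<bar>B\<bar> + 4"
    then have "4 * t \<le> t * t" by (intro mult_right_mono) auto
    moreover have "4 * B \<le> - (t * t)"
      using B[OF xy_point_in_real_points, of "1 / 2" t] by (simp add: eval power2_eq_square)
    moreover have "- B < t" by (simp add: t_def)
    ultimately show False by linarith
  qed
  ultimately show ?thesis by (intro exI[of _ 2] exI[of _ f]) auto
qed

section \<open>The implications and their strictness\<close>

theorem proposition5:
  shows "(\<forall>n f. n \<ge> 1 \<and> f \<in> poly_ring n \<and> total_degree f > 0 \<longrightarrow>
            (positive_definite n (leading_form f) \<longrightarrow> compact_sublevel_sets n f) \<and>
            (compact_sublevel_sets n f \<longrightarrow> has_integer_minimizer n f) \<and>
            (has_integer_minimizer n f \<longrightarrow> inf_on (int_points n) f > -\<infinity>) \<and>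
            (inf_on (int_points n) f > -\<infinity> \<longrightarrow> positive_semidefinite n (leading_form f)) \<and>
            (positive_semidefinite n (leading_form f) \<longrightarrow> even (total_degree f)) \<and>
            (compact_sublevel_sets n f \<longleftrightarrow> coercive n f) \<and>
            (coercive n f \<longrightarrow> has_continuous_minimizer n f) \<and>
            (has_continuous_minimizer n f \<longrightarrow> inf_on (real_points n) f > -\<infinity>) \<and>
            (inf_on (real_points n) f > -\<infinity> \<longrightarrow> inf_on (int_points n) f > -\<infinity>))
       \<and> (\<exists>n f. n \<ge> 1 \<and> f \<in> poly_ring n \<and> total_degree f > 0 \<and>
            \<not> (compact_sublevel_sets n f \<longrightarrow> positive_definite n (leading_form f)))
       \<and> (\<exists>n f. n \<ge> 1 \<and> f \<in> poly_ring n \<and> total_degree f > 0 \<and>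
            \<not> (has_integer_minimizer n f \<longrightarrow> compact_sublevel_sets n f))
       \<and> (\<exists>n f. n \<ge> 1 \<and> f \<in> poly_ring n \<and> total_degree f > 0 \<and>
            \<not> (inf_on (int_points n) f > -\<infinity> \<longrightarrow> has_integer_minimizer n f))
       \<and> (\<exists>n f. n \<ge> 1 \<and> f \<in> poly_ring n \<and> total_degree f > 0 \<and>
            \<not> (positive_semidefinite n (leading_form f) \<longrightarrow> inf_on (int_points n) f > -\<infinity>))
       \<and> (\<exists>n f. n \<ge> 1 \<and> f \<in> poly_ring n \<and> total_degree f > 0 \<and>
            \<not> (even (total_degree f) \<longrightarrow> positive_semidefinite n (leading_form f)))
       \<and> (\<exists>n f. n \<ge> 1 \<and> f \<in> poly_ring n \<and> total_degree f > 0 \<and>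
            \<not> (has_continuous_minimizer n f \<longrightarrow> coercive n f))
       \<and> (\<exists>n f. n \<ge> 1 \<and> f \<in> poly_ring n \<and> total_degree f > 0 \<and>
            \<not> (inf_on (real_points n) f > -\<infinity> \<longrightarrow> has_continuous_minimizer n f))
       \<and> (\<exists>n f. n \<ge> 1 \<and> f \<in> poly_ring n \<and> total_degree f > 0 \<and>
            \<not> (inf_on (int_points n) f > -\<infinity> \<longrightarrow> inf_on (real_points n) f > -\<infinity>))"
proof (intro conjI allI impI)
  fix n f assume *: "n \<ge> 1 \<and> f \<in> poly_ring n \<and> total_degree f > 0"
  show "compact_sublevel_sets n f" if "positive_definite n (leading_form f)"
    unfolding compact_sublevel_sets_iff_coercive
    using * that by (intro coercive_if_positive_definite) auto
  show "has_integer_minimizer n f" if "compact_sublevel_sets n f"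
    unfolding has_integer_minimizer_def
    using minimizer_on_closed_subset[OF that closed_int_points int_points_subset]
      zero_mem_int_points by blast
  show "inf_on (int_points n) f > -\<infinity>" if "has_integer_minimizer n f"
    using that by (auto simp: has_integer_minimizer_def dest: inf_on_gt_MInfty_if_attained)
  show "positive_semidefinite n (leading_form f)" if "inf_on (int_points n) f > -\<infinity>"
    using * that by (intro positive_semidefinite_if_bounded_below) auto
  show "even (total_degree f)" if "positive_semidefinite n (leading_form f)"
    using * that by (intro even_degree_if_positive_semidefinite) auto
  show "compact_sublevel_sets n f \<longleftrightarrow> coercive n f"
    by (rule compact_sublevel_sets_iff_coercive)
  show "has_continuous_minimizer n f" if "coercive n f"
    unfolding has_continuous_minimizer_def
    using that[folded compact_sublevel_sets_iff_coercive]
      zero_mem_int_points int_points_subset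
    by (intro minimizer_on_closed_subset closed_real_points) auto
  show "inf_on (real_points n) f > -\<infinity>" if "has_continuous_minimizer n f"
    using that by (auto simp: has_continuous_minimizer_def dest: inf_on_gt_MInfty_if_attained)
  show "inf_on (int_points n) f > -\<infinity>" if "inf_on (real_points n) f > -\<infinity>"
    using that int_points_subset unfolding inf_on_bounded_below_iff by blast
qed (simp_all only: not_imp compact_not_imp_positive_definite
    integer_minimizer_not_imp_compact continuous_minimizer_not_imp_coercive
    bounded_below_not_imp_integer_minimizer positive_semidefinite_not_imp_bounded_below
    even_degree_not_imp_positive_semidefinite bounded_below_not_imp_continuous_minimizer
    integer_bounded_below_not_imp_bounded_below)

end
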